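(* Let $G$ be a graph such that every two distinct vertices of degree at least $3$ are at distance at least $3$. Then $\chi_{\rm pcf}(G)\le5$.
   Context: All graphs are simple, finite and undirected. A vertex coloring of a graph is proper if adjacent vertices get distinct colors. It is conflict-free (with respect to open neighborhoods) if for every non-isolated vertex $x$ there is a color that appears exactly once on the open neighborhood $N(x)$. A PCF $k$-coloring is a vertex coloring with at most $k$ colors that is both proper and conflict-free. The PCF chromatic number $\chi_{\rm pcf}(G)$ is the minimum $k$ for which $G$ admits a PCF $k$-coloring. Distance is the usual graph distance (infinite for vertices in different components). *)

theory Defs
  imports Graph_Theory.Graph_Theory
begin

text \<open>
  A simple finite undirected graph is an element of the locale \<^locale>\<open>graph\<close>: a finite symmetric
  digraph without loops or parallel arcs, so every edge is a pair of opposite arcs. The degree of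
  a vertex is then its \<^const>\<open>out_degree\<close>; see \<open>out_degree_eq_card_nbhd\<close> below.
\<close>

definition nbhd :: "('a, 'b) pre_digraph \<Rightarrow> 'a \<Rightarrow> 'a set" where
  "nbhd G x = {y. x \<rightarrow>\<^bsub>G\<^esub> y}"

text \<open>The shortest-path distance for unit arc weights; it is \<open>\<infinity>\<close> if there is no walk.\<close>

definition graph_dist :: "('a, 'b) pre_digraph \<Rightarrow> 'a \<Rightarrow> 'a \<Rightarrow> ereal" where
  "graph_dist G u v = wf_digraph.\<mu> G (\<lambda>_. 1) u v"

definition proper_coloring :: "('a, 'b) pre_digraph \<Rightarrow> ('a \<Rightarrow> nat) \<Rightarrow> bool" where
  "proper_coloring G c \<longleftrightarrow> (\<forall>x\<in>verts G. \<forall>y\<in>verts G. x \<rightarrow>\<^bsub>G\<^esub> y \<longrightarrow> c x \<noteq> c y)"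

definition conflict_free :: "('a, 'b) pre_digraph \<Rightarrow> ('a \<Rightarrow> nat) \<Rightarrow> bool" where
  "conflict_free G c \<longleftrightarrow>
     (\<forall>x\<in>verts G. nbhd G x \<noteq> {} \<longrightarrow> (\<exists>i. \<exists>!y. y \<in> nbhd G x \<and> c y = i))"

definition pcf_coloring :: "('a, 'b) pre_digraph \<Rightarrow> nat \<Rightarrow> ('a \<Rightarrow> nat) \<Rightarrow> bool" where
  "pcf_coloring G k c \<longleftrightarrow>
     card (c ` verts G) \<le> k \<and> proper_coloring G c \<and> conflict_free G c"

definition pcf_chromatic_number :: "('a, 'b) pre_digraph \<Rightarrow> nat" where
  "pcf_chromatic_number G = (LEAST k. \<exists>c. pcf_coloring G k c)"

lemma (in graph) out_degree_eq_card_nbhd: "out_degree G x = card (nbhd G x)"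
proof -
  have "nbhd G x = head G ` out_arcs G x"
    by (auto simp: nbhd_def out_arcs_def arcs_ends_conv)
  moreover have "inj_on (head G) (out_arcs G x)"
    by (auto simp: inj_on_def out_arcs_def arc_to_ends_def intro!: no_multi_arcs)
  ultimately show ?thesis
    by (simp add: out_degree_def card_image)
qed

lemma (in wf_digraph) graph_dist_eq_INF_length:
  "graph_dist G u v = (INF p\<in>{p. awalk u p v}. ereal (real (length p)))"
proof -
  have "awalk_cost (\<lambda>_. 1) p = real (length p)" for p :: "'b awalk"
    by (induct p) auto
  then show ?thesis
    by (simp add: graph_dist_def \<mu>_def)
qed

text \<open>The minimum in \<^const>\<open>pcf_chromatic_number\<close> exists, since an injective coloring is PCF.\<close>

lemma (in graph) pcf_coloring_exists: "\<exists>c. pcf_coloring G (card (verts G)) c"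
proof -
  obtain c :: "'a \<Rightarrow> nat" where c: "inj_on c (verts G)"
    using finite_imp_inj_to_nat_seg[OF finite_verts] by blast
  have "proper_coloring G c"
    unfolding proper_coloring_def
    using c no_loops by (force simp: arcs_ends_conv inj_on_def)
  moreover have "conflict_free G c"
    unfolding conflict_free_def
  proof (intro ballI impI)
    fix x assume "nbhd G x \<noteq> {}"
    then obtain y where "y \<in> nbhd G x" by blast
    moreover have "nbhd G x \<subseteq> verts G"
      by (auto simp: nbhd_def arcs_ends_conv)
    ultimately show "\<exists>i. \<exists>!y. y \<in> nbhd G x \<and> c y = i"
      using c by (intro exI[of _ "c y"] ex1I[of _ y]) (auto simp: inj_on_def)
  qed
  ultimately show ?thesis
    by (auto simp: pcf_coloring_def card_image_le)
qed

lemma (in graph) pcf_chromatic_number_le_iff: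
  "pcf_chromatic_number G \<le> k \<longleftrightarrow> (\<exists>c. pcf_coloring G k c)"
proof
  have "\<exists>c. pcf_coloring G (pcf_chromatic_number G) c"
    unfolding pcf_chromatic_number_def using pcf_coloring_exists by (rule LeastI)
  then show "\<exists>c. pcf_coloring G k c" if "pcf_chromatic_number G \<le> k"
    using that by (auto simp: pcf_coloring_def intro: order_trans)
  show "pcf_chromatic_number G \<le> k" if "\<exists>c. pcf_coloring G k c"
    unfolding pcf_chromatic_number_def using that by (rule Least_le)
qed

end

(* Colour greedily with five colours. Fix a neighbour w(v) of every vertex v of degree at least 3
   and ask, besides properness, that the two neighbours of every vertex of degree 2 get distinct
   colours and that no other neighbour of v gets the colour of w(v). Take the vertices of degree at
   least 3 first, then the vertices w(v), then all others. Vertices of degree at least 3 do not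
   constrain each other. Any other vertex x has at most two neighbours z, each of which forbids at
   most two colours: its own, and that of w(z) or of the second neighbour of z. *)

theory Submission
  imports Defs
begin

text \<open>Elements are coloured by increasing \<open>rank\<close>. The order inside a rank class
  is left open, so \<open>few\<close> counts conflicts of equal rank in both directions.\<close>

lemma greedy_coloring:
  fixes rank :: "'a \<Rightarrow> nat" and R :: "'a \<Rightarrow> 'a \<Rightarrow> bool"
  assumes "finite V"
    and sym: "\<And>x y. R x y \<Longrightarrow> R y x"
    and few: "\<And>x. x \<in> V \<Longrightarrow> card {y \<in> V. y \<noteq> x \<and> R x y \<and> rank y \<le> rank x} < k"
  shows "\<exists>c :: 'a \<Rightarrow> nat. c ` V \<subseteq> {..<k} \<and> (\<forall>x\<in>V. \<forall>y\<in>V. x \<noteq> y \<and> R x y \<longrightarrow> c x \<noteq> c y)"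
  using \<open>finite V\<close> few
proof (induction V rule: finite_ranking_induct[where f = rank])
  case empty
  show ?case by simp
next
  case (insert x V)
  have "card {y \<in> V. y \<noteq> z \<and> R z y \<and> rank y \<le> rank z} < k" if "z \<in> V" for z
  proof -
    have "card {y \<in> V. y \<noteq> z \<and> R z y \<and> rank y \<le> rank z}
        \<le> card {y \<in> insert x V. y \<noteq> z \<and> R z y \<and> rank y \<le> rank z}"
      using insert.hyps(1) by (intro card_mono) auto
    also have "\<dots> < k"
      using insert.prems that by simp
    finally show ?thesis .
  qed
  then obtain c :: "'a \<Rightarrow> nat" where c: "c ` V \<subseteq> {..<k}"
    and proper: "\<And>y z. y \<in> V \<Longrightarrow> z \<in> V \<Longrightarrow> y \<noteq> z \<Longrightarrow> R y z \<Longrightarrow> c y \<noteq> c z"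
    using insert.IH by auto
  let ?B = "{y \<in> V. y \<noteq> x \<and> R x y}"
  \<comment> \<open>The induction inserts an element of maximal rank, so the rank condition removes
    none of its conflicts.\<close>
  have "?B = {y \<in> insert x V. y \<noteq> x \<and> R x y \<and> rank y \<le> rank x}"
    using insert.hyps(2) by auto
  then have "card ?B < k"
    using insert.prems[of x] by simp
  then have "card (c ` ?B) < card {..<k}"
    using card_image_le[of ?B c] insert.hyps(1) by simp
  then have "\<not> {..<k} \<subseteq> c ` ?B"
    using insert.hyps(1) card_mono[of "c ` ?B" "{..<k}"] by fastforce
  then obtain i where i: "i < k" "i \<notin> c ` ?B"
    by auto
  show ?case
  proof (intro exI[of _ "c(x := i)"] conjI ballI impI)
    show "(c(x := i)) ` insert x V \<subseteq> {..<k}"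
      using c i by auto
  next
    fix y z assume "y \<in> insert x V" "z \<in> insert x V" "y \<noteq> z \<and> R y z"
    then show "(c(x := i)) y \<noteq> (c(x := i)) z"
      using i proper[of y z] sym[of y z] by (auto simp: image_iff)
  qed
qed

context graph
begin

lemma in_nbhd_sym: "y \<in> nbhd G x \<longleftrightarrow> x \<in> nbhd G y"
  by (auto simp: nbhd_def dest: graph_symmetric)

lemma nbhd_subset_verts: "nbhd G x \<subseteq> verts G"
  by (auto simp: nbhd_def)

lemma finite_nbhd: "finite (nbhd G x)"
  using nbhd_subset_verts finite_verts by (rule finite_subset)

lemma not_in_nbhd_self: "x \<notin> nbhd G x"
  using adj_not_same by (auto simp: nbhd_def)

lemma graph_dist_le_length: "awalk u p v \<Longrightarrow> graph_dist G u v \<le> ereal (real (length p))"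
  unfolding graph_dist_eq_INF_length by (rule INF_lower) simp

lemma graph_dist_adjacent:
  assumes "y \<in> nbhd G x"
  shows "graph_dist G x y \<le> 1"
proof -
  obtain e where "e \<in> arcs G" "tail G e = x" "head G e = y"
    using assms by (auto simp: nbhd_def arcs_ends_conv)
  then have "awalk x [e] y"
    using arc_implies_awalk by auto
  then show ?thesis
    using graph_dist_le_length[of x "[e]" y] by (simp add: one_ereal_def)
qed

lemma graph_dist_common_nbr:
  assumes "x \<in> nbhd G z" "y \<in> nbhd G z"
  shows "graph_dist G x y \<le> 2"
proof -
  have "z \<in> nbhd G x"
    using assms(1) in_nbhd_sym by simp
  then obtain e f where "e \<in> arcs G" "tail G e = x" "head G e = z"
    "f \<in> arcs G" "tail G f = z" "head G f = y"
    using assms(2) by (auto simp: nbhd_def arcs_ends_conv)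
  then have "awalk x [e] z" "awalk z [f] y"
    using arc_implies_awalk[of e] arc_implies_awalk[of f] by simp_all
  then have "awalk x ([e] @ [f]) y"
    by (rule awalk_appendI)
  then show ?thesis
    using graph_dist_le_length[of x "[e] @ [f]" y] by simp
qed

text \<open>Conflict-freeness becomes a set of inequalities between pairs of colours, the form that
  greedy colouring can handle. If two neighbours at most are present and differ in colour, either
  one has a unique colour.\<close>

lemma pcf_coloringI:
  assumes "c ` verts G \<subseteq> {..<k}"
    and proper: "\<And>x y. y \<in> nbhd G x \<Longrightarrow> c x \<noteq> c y"
    and small: "\<And>x y z. \<lbrakk>card (nbhd G x) \<le> 2; y \<in> nbhd G x; z \<in> nbhd G x; y \<noteq> z\<rbrakk> \<Longrightarrow> c y \<noteq> c z"
    and large: "\<And>x. 3 \<le> card (nbhd G x) \<Longrightarrow> \<exists>y\<in>nbhd G x. \<forall>z\<in>nbhd G x. z \<noteq> y \<longrightarrow> c z \<noteq> c y"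
  shows "pcf_coloring G k c"
proof -
  have "\<exists>i. \<exists>!y. y \<in> nbhd G x \<and> c y = i" if ne: "nbhd G x \<noteq> {}" for x
  proof -
    have "\<exists>y\<in>nbhd G x. \<forall>z\<in>nbhd G x. z \<noteq> y \<longrightarrow> c z \<noteq> c y"
      using ne small[of x] large[of x] by (cases "card (nbhd G x) \<le> 2") (blast, simp)
    then show ?thesis
      by metis
  qed
  moreover have "card (c ` verts G) \<le> k"
    using card_mono[OF _ assms(1)] by simp
  ultimately show ?thesis
    using proper
    by (auto simp: pcf_coloring_def proper_coloring_def conflict_free_def nbhd_def)
qed

end

theorem mainTheorem11:
  fixes G :: "('a, 'b) pre_digraph"
  assumes "graph G"
    and "\<And>u v. \<lbrakk>u \<in> verts G; v \<in> verts G; u \<noteq> v; 3 \<le> out_degree G u; 3 \<le> out_degree G v\<rbrakk>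
           \<Longrightarrow> 3 \<le> graph_dist G u v"
  shows "pcf_chromatic_number G \<le> 5"
proof -
  interpret graph G by fact
  let ?N = "nbhd G"
  define big where "big v \<longleftrightarrow> v \<in> verts G \<and> 3 \<le> card (?N v)" for v
  define w where "w v = (SOME y. y \<in> ?N v)" for v
  have w: "w v \<in> ?N v" if "big v" for v
  proof -
    have "?N v \<noteq> {}"
      using that by (auto simp: big_def)
    then show ?thesis
      by (simp add: w_def some_in_eq)
  qed
  have far: "3 \<le> graph_dist G u v" if "big u" "big v" "u \<noteq> v" for u v
    using assms(2) that by (simp add: big_def out_degree_eq_card_nbhd)
  have not_adj: "\<not> big u" if "big v" "u \<in> ?N v" for u v
  proof
    assume "big u"
    moreover have "u \<noteq> v"
      using that not_in_nbhd_self by auto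
    ultimately have "3 \<le> graph_dist G v u"
      using far that(1) by simp
    also have "\<dots> \<le> 1"
      using that(2) by (rule graph_dist_adjacent)
    finally show False by simp
  qed
  have unique_big: "u = v" if "big u" "big v" "u \<in> ?N z" "v \<in> ?N z" for u v z
  proof (rule ccontr)
    assume "u \<noteq> v"
    then have "3 \<le> graph_dist G u v"
      using far that by simp
    also have "\<dots> \<le> 2"
      using that(3,4) by (rule graph_dist_common_nbr)
    finally show False by simp
  qed
  \<comment> \<open>All pairs of neighbours of a non-big \<open>z\<close> conflict, but for big
    \<open>z\<close> only the pairs containing \<open>w z\<close>. \<open>R x x\<close> may hold, so
    conflicts are counted between distinct vertices only.\<close>
  define R where "R x y \<longleftrightarrow> y \<in> ?N x \<or> (\<exists>z. x \<in> ?N z \<and> y \<in> ?N z \<and> (big z \<longrightarrow> x = w z \<or> y = w z))"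
    for x y
  \<comment> \<open>A big \<open>v\<close> and its \<open>w v\<close> may each conflict with
    arbitrarily many neighbours of \<open>v\<close>; those must come later.\<close>
  define rank :: "'a \<Rightarrow> nat"
    where "rank x = (if big x then 0 else if x \<in> w ` Collect big then 1 else 2)" for x
  have few: "card {y \<in> verts G. y \<noteq> x \<and> R x y \<and> rank y \<le> rank x} < 5" (is "card ?B < 5")
    if x: "x \<in> verts G" for x
  proof (cases "big x")
    case True
    \<comment> \<open>Members of \<open>?B\<close> would have rank 0, hence be big, yet they would
      be adjacent to \<open>x\<close> or share a neighbour with it.\<close>
    have empty: "?B = {}"
      using True not_adj[of x] unique_big[of x] by (auto simp: R_def rank_def split: if_splits)
    show ?thesis
      unfolding empty by simp
  next
    case False
    \<comment> \<open>\<open>g z\<close> holds the vertices that may block a colour for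
      \<open>x\<close> through \<open>z\<close>, besides \<open>z\<close> itself. For non-big
      \<open>z\<close> there is at most one, as \<open>x\<close> is one of at most two
      neighbours.\<close>
    define g where "g z = (if big z then {w z} else ?N z - {x})" for z
    have N_x: "card (?N x) \<le> 2"
      using False x by (simp add: big_def)
    have g: "finite (g z)" "card (g z) \<le> 1" if "z \<in> ?N x" for z
      using that nbhd_subset_verts[of x] finite_nbhd[of z] in_nbhd_sym[of z x]
      by (auto simp: g_def big_def)
    have "?B \<subseteq> ?N x \<union> (\<Union>z\<in>?N x. g z)"
    proof
      fix y assume y: "y \<in> ?B"
      show "y \<in> ?N x \<union> (\<Union>z\<in>?N x. g z)"
      proof (cases "y \<in> ?N x")
        case False
        then obtain z where z: "x \<in> ?N z" "y \<in> ?N z" "big z \<longrightarrow> x = w z \<or> y = w z"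
          using y by (auto simp: R_def)
        \<comment> \<open>Otherwise \<open>x = w z\<close> has rank at most 1. But \<open>y\<close>
          is not big, and \<open>y = w v\<close> for a big \<open>v\<close> would make
          \<open>v\<close> and \<open>z\<close> two big neighbours of \<open>y\<close>, so
          \<open>v = z\<close>. Thus \<open>y\<close> has rank 2 and comes too late.\<close>
        have "y = w z" if "big z"
        proof (rule ccontr)
          assume "y \<noteq> w z"
          then have "rank x \<le> 1"
            using z(3) that by (auto simp: rank_def)
          moreover have "y \<notin> w ` Collect big"
            using unique_big[of z _ y] w z(2) \<open>y \<noteq> w z\<close> that in_nbhd_sym by blast
          then have "rank y = 2"
            using not_adj[OF that z(2)] by (simp add: rank_def)
          ultimately show False
            using y by simp
        qed
        then have "y \<in> g z"
          using y z by (auto simp: g_def)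
        then show ?thesis
          using z(1) in_nbhd_sym by blast
      qed simp
    qed
    \<comment> \<open>At most two neighbours, and at most one more vertex through each, give at most
      four conflicts.\<close>
    then have "card ?B \<le> card (?N x \<union> (\<Union>z\<in>?N x. g z))"
      using finite_nbhd g by (intro card_mono) auto
    also have "\<dots> \<le> card (?N x) + card (\<Union>z\<in>?N x. g z)"
      by (rule card_Un_le)
    also have "card (\<Union>z\<in>?N x. g z) \<le> (\<Sum>z\<in>?N x. card (g z))"
      using finite_nbhd by (rule card_UN_le)
    also have "(\<Sum>z\<in>?N x. card (g z)) \<le> card (?N x)"
      using sum_bounded_above[of "?N x" "\<lambda>z. card (g z)" 1] g by simp
    finally show ?thesis
      using N_x by simp
  qed
  have sym: "R y x" if "R x y" for x y
    using that in_nbhd_sym by (auto simp: R_def)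
  obtain c :: "'a \<Rightarrow> nat" where c: "c ` verts G \<subseteq> {..<5}"
    and R_c: "\<And>x y. \<lbrakk>x \<in> verts G; y \<in> verts G; x \<noteq> y; R x y\<rbrakk> \<Longrightarrow> c x \<noteq> c y"
    using greedy_coloring[of "verts G" R rank 5, OF finite_verts sym few] by auto
  have "pcf_coloring G 5 c"
  proof (rule pcf_coloringI[OF c])
    fix x y assume "y \<in> ?N x"
    moreover from this have "x \<in> ?N y"
      using in_nbhd_sym by simp
    moreover have "x \<noteq> y"
      using \<open>y \<in> ?N x\<close> not_in_nbhd_self by auto
    ultimately show "c x \<noteq> c y"
      using nbhd_subset_verts by (intro R_c) (auto simp: R_def)
  next
    fix x y z assume "card (?N x) \<le> 2" "y \<in> ?N x" "z \<in> ?N x" "y \<noteq> z"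
    \<comment> \<open>Here \<open>x\<close> is the common neighbour in \<open>R\<close>; it is not
      big, so the condition on \<open>w\<close> is vacuous.\<close>
    then show "c y \<noteq> c z"
      using nbhd_subset_verts by (intro R_c) (auto simp: R_def big_def)
  next
    fix x assume deg: "3 \<le> card (?N x)"
    \<comment> \<open>\<open>big x\<close> includes \<open>x \<in> verts G\<close>, which follows
      from \<open>x\<close> having a neighbour.\<close>
    then obtain y where "y \<in> ?N x"
      by fastforce
    then have "x \<in> ?N y"
      using in_nbhd_sym by simp
    then have "x \<in> verts G"
      using nbhd_subset_verts by blast
    then have w_x: "w x \<in> ?N x"
      using deg w by (simp add: big_def)
    then have "c z \<noteq> c (w x)" if "z \<in> ?N x" "z \<noteq> w x" for z
      using that nbhd_subset_verts by (intro R_c) (auto simp: R_def)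
    then show "\<exists>y\<in>?N x. \<forall>z\<in>?N x. z \<noteq> y \<longrightarrow> c z \<noteq> c y"
      using w_x by blast
  qed
  then show ?thesis
    using pcf_chromatic_number_le_iff by blast
qed

end
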